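(* Let $n\ge 1$. Two continuous maps $f,g:\mathsf{R}^n\to\mathsf{R}$ are homotopic if and only if $\mathfrak{C}(f)=\mathfrak{C}(g)$.
   Context: $\mathsf{R}$ denotes Alexandroff's closed long ray: the set $\omega_1\times[0,1[$ with the lexicographic order $\le$ and the order topology; its least element is denoted $0$. $\mathsf{R}^n$ has the product topology. Let $N=\{1,\dots,n\}$. For $x\in\mathsf{R}^n$ and $I=\{i_1<\dots<i_k\}\subset N$, write $x_I=(x_{i_1},\dots,x_{i_k})$. For $I\subset N$ and $c\in\mathsf{R}^{n-|I|}$ set $\Delta_I(c)=\{x\in\mathsf{R}^n: x_i=x_{i'}\text{ for all }i,i'\in I,\ x_{N\setminus I}=c\}$, and $\Delta_I=\Delta_I(0,\dots,0)$. A map into $\mathsf{R}$ is bounded if its image is contained in $[0,z]$ for some $z\in\mathsf{R}$, and unbounded otherwise. A continuous $f:\mathsf{R}^n\to\mathsf{R}$ is $I$-cofinal if $f|_{\Delta_I}$ is unbounded. The cofinality class of $f$ is $\mathfrak{C}(f)=\{I\subset N: f\text{ is }I\text{-cofinal}\}$. Homotopy means free homotopy. *)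

theory Defs
  imports "HOL-Analysis.Analysis"
begin

section \<open>The first uncountable ordinal\<close>

text \<open>The initial ordinal of the successor cardinal of \<open>\<aleph>\<^sub>0\<close>, with its ordinal order
  transferred to a type.\<close>

typedef omega1 = "Field (cardSuc natLeq)"
proof -
  have "\<not> finite (Field (cardSuc natLeq))"
    using cardSuc_finite[OF natLeq_Card_order] by (simp add: Field_natLeq)
  then show ?thesis
    by (metis ex_in_conv finite.emptyI)
qed

lemma cardSuc_natLeq_Well_order: "Well_order (cardSuc natLeq)"
  using cardSuc_Card_order[OF natLeq_Card_order] by (simp add: card_order_on_def)

instantiation omega1 :: linorder
begin

definition less_eq_omega1 :: "omega1 \<Rightarrow> omega1 \<Rightarrow> bool" where
  "a \<le> b \<longleftrightarrow> (Rep_omega1 a, Rep_omega1 b) \<in> cardSuc natLeq"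

definition less_omega1 :: "omega1 \<Rightarrow> omega1 \<Rightarrow> bool" where
  "(a :: omega1) < b \<longleftrightarrow> a \<le> b \<and> a \<noteq> b"

instance
proof
  let ?r = "cardSuc natLeq"
  have lin: "linear_order_on (Field ?r) ?r" and wf: "wf (?r - Id)"
    using cardSuc_natLeq_Well_order by (simp_all add: well_order_on_def)
  have po: "refl_on (Field ?r) ?r" "trans ?r" "antisym ?r" and tot: "total_on (Field ?r) ?r"
    using lin by (simp_all add: linear_order_on_def partial_order_on_def preorder_on_def)
  fix a b c :: omega1
  show refl: "a \<le> a"
    using po(1) Rep_omega1[of a] by (simp add: less_eq_omega1_def refl_on_def)
  show "a \<le> b \<Longrightarrow> b \<le> c \<Longrightarrow> a \<le> c"
    using po(2) unfolding less_eq_omega1_def by (meson transD)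
  show anti: "a \<le> b \<Longrightarrow> b \<le> a \<Longrightarrow> a = b"
    using po(3) unfolding less_eq_omega1_def by (meson antisymD Rep_omega1_inject)
  show "(a < b) = (a \<le> b \<and> \<not> b \<le> a)"
    using anti refl by (auto simp: less_omega1_def)
  show "a \<le> b \<or> b \<le> a"
    using tot Rep_omega1[of a] Rep_omega1[of b] refl
    unfolding less_eq_omega1_def total_on_def by (metis Rep_omega1_inject)
qed

end

instance omega1 :: wellorder
proof
  fix P :: "omega1 \<Rightarrow> bool" and a :: omega1
  assume step: "\<And>x. (\<And>y. y < x \<Longrightarrow> P y) \<Longrightarrow> P x"
  have "wf (cardSuc natLeq - Id)"
    using cardSuc_natLeq_Well_order by (simp add: well_order_on_def)
  then have "wf (inv_image (cardSuc natLeq - Id) Rep_omega1)"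
    by (rule wf_inv_image)
  then show "P a"
  proof (induction a rule: wf_induct_rule)
    case (less x)
    show ?case
      by (rule step, rule less)
        (simp add: less_omega1_def less_eq_omega1_def Rep_omega1_inject)
  qed
qed

text \<open>These two facts characterise the order type \<open>\<omega>\<^sub>1\<close>.\<close>

lemma uncountable_omega1:
  includes cardinal_syntax
  shows "uncountable (UNIV :: omega1 set)"
proof
  assume "countable (UNIV :: omega1 set)"
  then have "countable (Field (cardSuc natLeq))"
    by (metis countable_image type_definition.Rep_range type_definition_omega1)
  then have "|Field (cardSuc natLeq)| \<le>o |UNIV :: nat set|"
    unfolding countable_def card_of_ordLeq[symmetric] by auto
  then have "cardSuc natLeq \<le>o natLeq"
    by (meson card_of_Field_ordIso cardSuc_Card_order natLeq_Card_order card_of_nat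
        ordIso_ordLeq_trans ordIso_symmetric ordLeq_ordIso_trans)
  then show False
    using cardSuc_greater[OF natLeq_Card_order] not_ordLess_ordLeq by blast
qed

lemma countable_lessThan_omega1:
  includes cardinal_syntax
  shows "countable {..<a :: omega1}"
proof -
  let ?U = "underS (cardSuc natLeq) (Rep_omega1 a)"
  have "|?U| <o cardSuc natLeq"
    using card_of_underS[OF cardSuc_Card_order[OF natLeq_Card_order] Rep_omega1] .
  then have "|?U| \<le>o natLeq"
    using cardSuc_ordLeq_ordLess[OF natLeq_Card_order card_of_Card_order] by blast
  then have "|?U| \<le>o |UNIV :: nat set|"
    by (meson card_of_nat ordIso_symmetric ordLeq_ordIso_trans)
  then have "countable ?U"
    unfolding countable_def card_of_ordLeq[symmetric] by auto
  moreover have "Rep_omega1 ` {..<a} \<subseteq> ?U"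
    by (auto simp: underS_def less_omega1_def less_eq_omega1_def Rep_omega1_inject)
  ultimately have "countable (Rep_omega1 ` {..<a})"
    by (rule countable_subset[rotated])
  then show ?thesis
    by (rule countable_image_inj_on) (simp add: inj_on_def Rep_omega1_inject)
qed

section \<open>The closed long ray\<close>

typedef long_ray = "(UNIV :: omega1 set) \<times> {0..<1 :: real}"
  by (rule exI[of _ "(undefined, 0)"]) simp

instantiation long_ray :: linorder
begin

definition less_eq_long_ray :: "long_ray \<Rightarrow> long_ray \<Rightarrow> bool" where
  "x \<le> y \<longleftrightarrow> fst (Rep_long_ray x) < fst (Rep_long_ray y) \<or>
     fst (Rep_long_ray x) = fst (Rep_long_ray y) \<and> snd (Rep_long_ray x) \<le> snd (Rep_long_ray y)"

definition less_long_ray :: "long_ray \<Rightarrow> long_ray \<Rightarrow> bool" where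
  "(x :: long_ray) < y \<longleftrightarrow> x \<le> y \<and> \<not> y \<le> x"

instance
  by standard
    (auto simp: less_eq_long_ray_def less_long_ray_def Rep_long_ray_inject[symmetric] prod_eq_iff)

end

instantiation long_ray :: linorder_topology
begin

definition open_long_ray :: "long_ray set \<Rightarrow> bool" where
  "open_long_ray = generate_topology (range (\<lambda>a. {..<a}) \<union> range (\<lambda>a. {a<..}))"

instance
  by standard (rule open_long_ray_def)

end

instantiation long_ray :: zero
begin

definition zero_long_ray :: long_ray where
  "0 = Abs_long_ray (LEAST a. True, 0)"

instance ..

end

lemma zero_le_long_ray: "(0 :: long_ray) \<le> x"
proof -
  have "(LEAST a. True) \<le> fst (Rep_long_ray x)"
    by (rule Least_le) simp
  moreover have "0 \<le> snd (Rep_long_ray x)"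
    using Rep_long_ray[of x] by (simp add: mem_Times_iff)
  ultimately show ?thesis
    by (auto simp: zero_long_ray_def less_eq_long_ray_def Abs_long_ray_inverse)
qed

section \<open>Powers of the long ray and cofinality classes\<close>

text \<open>Points of the \<open>n\<close>-th power are the extensional functions on \<open>{1..n}\<close>.\<close>

definition long_ray_power :: "nat \<Rightarrow> (nat \<Rightarrow> long_ray) topology" where
  "long_ray_power n = product_topology (\<lambda>_. euclidean) {1..n}"

text \<open>The tuple \<open>c\<close> of the remaining coordinates is indexed by \<open>{1..n} - I\<close> itself; its values
  elsewhere are irrelevant.\<close>

definition diag :: "nat \<Rightarrow> nat set \<Rightarrow> (nat \<Rightarrow> long_ray) \<Rightarrow> (nat \<Rightarrow> long_ray) set" where
  "diag n I c = {x \<in> topspace (long_ray_power n).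
     (\<forall>i\<in>I. \<forall>i'\<in>I. x i = x i') \<and> (\<forall>i\<in>{1..n} - I. x i = c i)}"

definition bounded_map_on :: "'a set \<Rightarrow> ('a \<Rightarrow> long_ray) \<Rightarrow> bool" where
  "bounded_map_on S f \<longleftrightarrow> (\<exists>z. f ` S \<subseteq> {0..z})"

definition cofinal_on_diag :: "nat \<Rightarrow> nat set \<Rightarrow> ((nat \<Rightarrow> long_ray) \<Rightarrow> long_ray) \<Rightarrow> bool" where
  "cofinal_on_diag n I f \<longleftrightarrow> \<not> bounded_map_on (diag n I (\<lambda>_. 0)) f"

definition cofinality_class :: "nat \<Rightarrow> ((nat \<Rightarrow> long_ray) \<Rightarrow> long_ray) \<Rightarrow> nat set set" where
  "cofinality_class n f = {I. I \<subseteq> {1..n} \<and> cofinal_on_diag n I f}"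

end

theory Submission
  imports Defs
begin

text \<open>
  Countable subsets of the long ray are bounded, so along a diagonal a continuous map is either
  bounded or tends to infinity, and for a family of maps over a connected second countable
  parameter space the same alternative holds throughout, uniformly in the parameter. A homotopy
  is such a family, hence preserves the cofinality class. Conversely, limits of interleaved
  sequences show that \<open>f x \<ge> z\<close> as soon as the coordinates of \<open>x\<close> in some \<open>I\<close> of the class are
  large, while \<open>f\<close> is bounded on \<open>{x. x\<^sub>i \<le> b for i \<notin> I}\<close> for \<open>I\<close> outside the class. Closing off,
  one finds, for two maps of the same class, arbitrarily large levels \<open>c\<close> such that at every \<open>x\<close>
  both values lie on the same side of \<open>c\<close>, namely above iff \<open>{i. c \<le> x\<^sub>i}\<close> is in the class. The two
  maps thus always take values in a common block between two such levels, and within the blocks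
  they can be deformed into their maximum.
\<close>

section \<open>Order and completeness of the long ray\<close>

text \<open>Without a strict upper bound, countably many countable initial segments would exhaust
  the uncountable \<open>omega1\<close>.\<close>

lemma countable_imp_bounded_omega1:
  assumes "countable (A :: omega1 set)"
  shows "\<exists>b. \<forall>a\<in>A. a < b"
proof (rule ccontr)
  assume "\<nexists>b. \<forall>a\<in>A. a < b"
  then have "(UNIV :: omega1 set) = (\<Union>a\<in>A. {..<a} \<union> {a})"
    by (auto simp: not_less) (metis order_le_less)
  moreover have "countable (\<Union>a\<in>A. {..<a} \<union> {a})"
    using assms countable_lessThan_omega1 by auto
  ultimately show False
    using uncountable_omega1 by simp
qed

definition lr_ord :: "long_ray \<Rightarrow> omega1" where "lr_ord x = fst (Rep_long_ray x)"
definition lr_frac :: "long_ray \<Rightarrow> real" where "lr_frac x = snd (Rep_long_ray x)"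
definition lr_point :: "omega1 \<Rightarrow> real \<Rightarrow> long_ray" where "lr_point a s = Abs_long_ray (a, s)"

lemma lr_frac_bounds: "0 \<le> lr_frac x" "lr_frac x < 1"
  using Rep_long_ray[of x] by (auto simp: lr_frac_def mem_Times_iff)

lemma lr_point_sel [simp]:
  assumes "0 \<le> s" "s < 1"
  shows "lr_ord (lr_point a s) = a" "lr_frac (lr_point a s) = s"
  using assms by (auto simp: lr_ord_def lr_frac_def lr_point_def Abs_long_ray_inverse)

lemma long_ray_le_iff:
  "x \<le> y \<longleftrightarrow> lr_ord x < lr_ord y \<or> lr_ord x = lr_ord y \<and> lr_frac x \<le> lr_frac y"
  by (simp add: less_eq_long_ray_def lr_ord_def lr_frac_def)

lemma long_ray_less_iff:
  "x < y \<longleftrightarrow> lr_ord x < lr_ord y \<or> lr_ord x = lr_ord y \<and> lr_frac x < lr_frac y"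
  by (auto simp: less_long_ray_def long_ray_le_iff)

text \<open>It suffices to exceed all ordinal parts. The later uniformity arguments rest on this:
  thresholds indexed by a countable set have a common one.\<close>

lemma countable_imp_bounded_long_ray:
  assumes "countable (A :: long_ray set)"
  shows "\<exists>b. \<forall>a\<in>A. a < b"
proof -
  obtain b where "\<forall>a\<in>lr_ord ` A. a < b"
    using countable_imp_bounded_omega1[of "lr_ord ` A"] assms by auto
  then have "\<forall>a\<in>A. a < lr_point b 0"
    by (simp add: long_ray_less_iff)
  then show ?thesis by blast
qed

lemma bdd_below_long_ray [simp]: "bdd_below (A :: long_ray set)"
  by (rule bdd_belowI[of _ 0]) (rule zero_le_long_ray)

text \<open>The least ordinal part occurring in \<open>A\<close> exists by well-ordering; the real
  infimum of the fractional parts over it completes the point.\<close>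

lemma long_ray_has_Inf:
  assumes "A \<noteq> {}"
  shows "\<exists>m :: long_ray. (\<forall>x\<in>A. m \<le> x) \<and> (\<forall>l. (\<forall>x\<in>A. l \<le> x) \<longrightarrow> l \<le> m)"
proof -
  define a where "a = (LEAST a. a \<in> lr_ord ` A)"
  define T where "T = lr_frac ` {x \<in> A. lr_ord x = a}"
  have a_in: "a \<in> lr_ord ` A"
    unfolding a_def using assms by (metis LeastI_ex ex_in_conv image_is_empty)
  have a_le: "a \<le> lr_ord x" if "x \<in> A" for x
    unfolding a_def by (rule Least_le) (use that in auto)
  have T: "T \<noteq> {}" "bdd_below T"
    using a_in lr_frac_bounds by (auto simp: T_def intro!: bdd_belowI[of _ 0])
  obtain x0 where x0: "x0 \<in> A" "lr_ord x0 = a"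
    using a_in by auto
  \<comment> \<open>This keeps \<open>Inf T\<close> below 1, so that
    \<open>lr_point a (Inf T)\<close> is a genuine point.\<close>
  have "Inf T \<le> lr_frac x0"
    by (rule cInf_lower) (use x0 T in \<open>auto simp: T_def\<close>)
  then have "Inf T < 1" "0 \<le> Inf T"
    using lr_frac_bounds T by (auto intro!: cInf_greatest simp: T_def intro: le_less_trans)
  note [simp] = lr_point_sel[OF this(2,1)]
  have "lr_point a (Inf T) \<le> x" if "x \<in> A" for x
  proof -
    have "Inf T \<le> lr_frac x" if "lr_ord x = a"
      by (rule cInf_lower) (use \<open>x \<in> A\<close> that T(2) in \<open>auto simp: T_def\<close>)
    then show ?thesis
      using a_le[OF that] by (auto simp: long_ray_le_iff order_le_less[of a])
  qed
  moreover have "l \<le> lr_point a (Inf T)" if l: "\<forall>x\<in>A. l \<le> x" for l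
  proof -
    have "lr_ord l \<le> a"
      using l x0 by (auto simp: long_ray_le_iff)
    moreover have "lr_frac l \<le> Inf T" if "lr_ord l = a"
      using that l T(1) by (intro cInf_greatest) (auto simp: long_ray_le_iff T_def)
    ultimately show ?thesis
      by (auto simp: long_ray_le_iff order_le_less)
  qed
  ultimately show ?thesis by blast
qed

instantiation long_ray :: conditionally_complete_linorder
begin

definition inf_long_ray :: "long_ray \<Rightarrow> long_ray \<Rightarrow> long_ray" where "inf_long_ray = min"

definition sup_long_ray :: "long_ray \<Rightarrow> long_ray \<Rightarrow> long_ray" where "sup_long_ray = max"

definition Inf_long_ray :: "long_ray set \<Rightarrow> long_ray" where
  "Inf_long_ray A = (SOME m. (\<forall>x\<in>A. m \<le> x) \<and> (\<forall>l. (\<forall>x\<in>A. l \<le> x) \<longrightarrow> l \<le> m))"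

text \<open>Since every nonempty set has an infimum, suprema of bounded sets are obtained as infima
  of upper bounds.\<close>

definition Sup_long_ray :: "long_ray set \<Rightarrow> long_ray" where
  "Sup_long_ray A = Inf {b. \<forall>x\<in>A. x \<le> b}"

instance
proof
  have Inf: "(\<forall>x\<in>A. Inf A \<le> x) \<and> (\<forall>l. (\<forall>x\<in>A. l \<le> x) \<longrightarrow> l \<le> Inf A)" if "A \<noteq> {}"
    for A :: "long_ray set"
    unfolding Inf_long_ray_def by (rule someI_ex, rule long_ray_has_Inf[OF that])
  fix x y z :: long_ray and A :: "long_ray set"
  show "inf x y \<le> x" "inf x y \<le> y" "x \<le> sup x y" "y \<le> sup x y"
    "x \<le> y \<Longrightarrow> x \<le> z \<Longrightarrow> x \<le> inf y z" "y \<le> x \<Longrightarrow> z \<le> x \<Longrightarrow> sup y z \<le> x"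
    by (simp_all add: inf_long_ray_def sup_long_ray_def)
  show "x \<in> A \<Longrightarrow> bdd_below A \<Longrightarrow> Inf A \<le> x"
    using Inf[of A] by blast
  show "A \<noteq> {} \<Longrightarrow> (\<And>y. y \<in> A \<Longrightarrow> x \<le> y) \<Longrightarrow> x \<le> Inf A"
    using Inf[of A] by blast
  show "x \<le> Sup A" if "x \<in> A" "bdd_above A"
    unfolding Sup_long_ray_def using that Inf[of "{b. \<forall>x\<in>A. x \<le> b}"]
    by (auto simp: bdd_above_def)
  show "Sup A \<le> x" if "A \<noteq> {}" "\<And>y. y \<in> A \<Longrightarrow> y \<le> x"
    unfolding Sup_long_ray_def using that Inf[of "{b. \<forall>x\<in>A. x \<le> b}"] by blast
qed

end

instance long_ray :: "{dense_linorder, no_top}"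
proof
  fix x y :: long_ray
  show "\<exists>z. x < z"
    using countable_imp_bounded_long_ray[of "{x}"] by auto
  assume "x < y"
  \<comment> \<open>The ordinal part of \<open>x\<close> is kept; the fraction moves halfway towards
    that of \<open>y\<close>, or halfway towards 1 if \<open>y\<close> has a larger ordinal
    part.\<close>
  define s where "s = (if lr_ord x = lr_ord y then (lr_frac x + lr_frac y) / 2 else (lr_frac x + 1) / 2)"
  have s: "0 \<le> s" "s < 1"
    using lr_frac_bounds[of x] lr_frac_bounds[of y] by (auto simp: s_def)
  have "x < lr_point (lr_ord x) s" "lr_point (lr_ord x) s < y"
    using \<open>x < y\<close> lr_frac_bounds[of x] s by (auto simp: long_ray_less_iff s_def)
  then show "\<exists>z>x. z < y" by blast
qed

text \<open>Points with rational fractional part over the ordinals up to that of \<open>z\<close>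
  suffice, and there are only countably many such ordinals.\<close>

lemma long_ray_countable_dense:
  "\<exists>D. countable D \<and> (\<forall>x y :: long_ray. x < y \<longrightarrow> y \<le> z \<longrightarrow> (\<exists>d\<in>D. x \<le> d \<and> d < y))"
proof (intro exI conjI allI impI)
  define D where "D = (\<lambda>(a, s). lr_point a s) ` (({..<lr_ord z} \<union> {lr_ord z}) \<times> \<rat>)"
  show "countable D"
    unfolding D_def using countable_lessThan_omega1 countable_rat by auto
  fix x y :: long_ray
  assume "x < y" "y \<le> z"
  \<comment> \<open>Points over the ordinal part of \<open>x\<close> stay below \<open>y\<close> as
    long as their fraction is below \<open>u\<close>.\<close>
  define u where "u = (if lr_ord x = lr_ord y then lr_frac y else 1)"
  have "lr_frac x < u" "u \<le> 1"
    using \<open>x < y\<close> lr_frac_bounds[of x] lr_frac_bounds[of y] by (auto simp: u_def long_ray_less_iff)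
  then obtain s where s: "s \<in> \<rat>" "lr_frac x < s" "s < u"
    using Rats_dense_in_real by blast
  then have s01: "0 \<le> s" "s < 1"
    using lr_frac_bounds[of x] \<open>u \<le> 1\<close> by auto
  have "lr_point (lr_ord x) s \<in> D"
    unfolding D_def using s \<open>x < y\<close> \<open>y \<le> z\<close>
    by (auto simp: long_ray_less_iff long_ray_le_iff intro!: rev_image_eqI[of "(lr_ord x, s)"])
  moreover have "x \<le> lr_point (lr_ord x) s" "lr_point (lr_ord x) s < y"
    using s s01 \<open>x < y\<close> by (auto simp: long_ray_less_iff long_ray_le_iff u_def split: if_splits)
  ultimately show "\<exists>d\<in>D. x \<le> d \<and> d < y" by blast
qed

text \<open>\<open>\<phi> x\<close> sums the weights \<open>(1/2)^k\<close> of those members of a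
  countable dense set that lie below \<open>x\<close>. For \<open>x < y\<close>, some member in
  \<open>{x..<y}\<close> is counted for \<open>y\<close> only.\<close>

lemma long_ray_embeds_in_real:
  "\<exists>\<phi> :: long_ray \<Rightarrow> real. strict_mono_on {..z} \<phi>"
proof -
  obtain D where D: "countable D" "\<forall>x y :: long_ray. x < y \<longrightarrow> y \<le> z \<longrightarrow> (\<exists>d\<in>D. x \<le> d \<and> d < y)"
    using long_ray_countable_dense[of z] by blast
  define w where "w x k = (if \<exists>d\<in>D. d < x \<and> to_nat_on D d = k then (1/2)^k else 0 :: real)" for x k
  have summ: "summable (w x)" for x
    by (rule summable_comparison_test[of _ "\<lambda>k. (1/2)^k"]) (auto simp: w_def intro!: exI[of _ 0])
  have "suminf (w x) < suminf (w y)" if "x < y" "y \<le> z" for x y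
  proof -
    obtain d where d: "d \<in> D" "x \<le> d" "d < y" using D(2) \<open>x < y\<close> \<open>y \<le> z\<close> by blast
    let ?k = "to_nat_on D d"
    have "w x ?k = 0" "w y ?k > 0"
      using d to_nat_on_inj[OF D(1)] by (auto simp: w_def)
    moreover have "w x k \<le> w y k" for k
      using that by (auto simp: w_def)
    moreover have "0 < (\<Sum>k. w y k - w x k)"
      using suminf_pos2[of "\<lambda>k. w y k - w x k" ?k] summable_diff[OF summ summ] calculation by simp
    ultimately show ?thesis
      using suminf_diff[OF summ[of y] summ[of x]] by simp
  qed
  then have "strict_mono_on {..z} (\<lambda>x. suminf (w x))"
    by (auto simp: strict_mono_on_def)
  then show ?thesis by blast
qed

text \<open>The embedding \<open>\<phi>\<close> may jump, but its generalised inverse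
  \<open>p\<close> is monotone and stays constant across the jumps; a monotone map with open image
  is continuous.\<close>

lemma long_ray_path_le:
  assumes "a \<le> (b :: long_ray)"
  shows "\<exists>p. continuous_on {0..1::real} p \<and> p 0 = a \<and> p 1 = b \<and> p ` {0..1} = {a..b}"
proof -
  obtain z where z: "b < z" using gt_ex by blast
  obtain \<phi> :: "long_ray \<Rightarrow> real" where \<phi>: "strict_mono_on {..z} \<phi>"
    using long_ray_embeds_in_real by blast
  have \<phi>_le: "\<phi> x \<le> \<phi> y \<longleftrightarrow> x \<le> y" if "x \<le> z" "y \<le> z" for x y
    using strict_mono_on_leD[OF \<phi>, of x y] strict_mono_onD[OF \<phi>, of y x] that
    by (auto simp: not_le[symmetric])
  define p where "p s = Sup {x. x \<le> z \<and> \<phi> x \<le> s}" for s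
  have p\<phi>: "p (\<phi> x) = x" if "x \<le> z" for x
    unfolding p_def using that by (intro cSup_eq_maximum) (auto simp: \<phi>_le)
  have mono: "p s \<le> p t" if "s \<le> t" "\<phi> 0 \<le> s" for s t
    unfolding p_def using that zero_le_long_ray[of z]
    by (intro cSup_subset_mono) (auto intro!: exI[of _ 0] bdd_aboveI[of _ z])
  \<comment> \<open>The values are cut off strictly below \<open>z\<close> to make the image the
    open set \<open>{..<z}\<close>; as \<open>b < z\<close>, the parameters from
    \<open>\<phi> a\<close> to \<open>\<phi> b\<close> remain in \<open>A\<close>.\<close>
  define A where "A = {s. \<phi> 0 \<le> s \<and> p s < z}"
  have "p ` A = {..<z}"
  proof
    show "{..<z} \<subseteq> p ` A"
    proof
      fix x assume "x \<in> {..<z}"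
      then have "p (\<phi> x) = x" "\<phi> x \<in> A"
        using zero_le_long_ray[of x] zero_le_long_ray[of z] by (auto simp: A_def p\<phi> \<phi>_le)
      then show "x \<in> p ` A" by (metis imageI)
    qed
  qed (auto simp: A_def)
  then have cont: "continuous_on A p"
    by (intro continuous_onI_mono) (auto simp: A_def intro: mono)
  have ab: "\<phi> 0 \<le> \<phi> a" "\<phi> a \<le> \<phi> b" "p (\<phi> a) = a" "p (\<phi> b) = b"
    using assms z zero_le_long_ray[of a] zero_le_long_ray[of z] by (simp_all add: \<phi>_le p\<phi>)
  have bounds: "a \<le> p s" "p s \<le> b" if "\<phi> a \<le> s" "s \<le> \<phi> b" for s
    using mono[of "\<phi> a" s] mono[of s "\<phi> b"] that ab by auto
  define l where "l t = \<phi> a + t * (\<phi> b - \<phi> a)" for t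
  have l: "l t \<in> {\<phi> a..\<phi> b}" if "t \<in> {0..1}" for t
    using that ab(2) mult_left_le_one_le[of "\<phi> b - \<phi> a" t] by (auto simp: l_def)
  have "continuous_on {0..1} (\<lambda>t. p (l t))"
  proof (rule continuous_on_compose2[OF cont])
    show "continuous_on {0..1} l"
      unfolding l_def by (intro continuous_intros)
    show "l ` {0..1} \<subseteq> A"
      using l ab(1) bounds z unfolding A_def by fastforce
  qed
  moreover have "(\<lambda>t. p (l t)) ` {0..1} = {a..b}"
  proof
    show "{a..b} \<subseteq> (\<lambda>t. p (l t)) ` {0..1}"
    proof
      fix x assume x: "x \<in> {a..b}"
      then have \<phi>x: "\<phi> a \<le> \<phi> x" "\<phi> x \<le> \<phi> b" "p (\<phi> x) = x"
        using z by (auto simp: \<phi>_le p\<phi>)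
      show "x \<in> (\<lambda>t. p (l t)) ` {0..1}"
      proof (cases "\<phi> a = \<phi> b")
        case True
        then show ?thesis using \<phi>x by (intro image_eqI[of _ _ 0]) (auto simp: l_def)
      next
        case False
        then have "\<phi> a < \<phi> b" using ab by simp
        then show ?thesis using \<phi>x
          by (intro image_eqI[of _ _ "(\<phi> x - \<phi> a) / (\<phi> b - \<phi> a)"]) (auto simp: l_def)
      qed
    qed
  qed (use l bounds in auto)
  moreover have "p (l 0) = a" "p (l 1) = b"
    using ab by (simp_all add: l_def)
  ultimately show ?thesis
    by (intro exI[of _ "\<lambda>t. p (l t)"]) simp
qed

lemma long_ray_path:
  "\<exists>p. continuous_on {0..1::real} p \<and> p 0 = (a :: long_ray) \<and> p 1 = b"
proof (cases "a \<le> b")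
  case True
  then show ?thesis using long_ray_path_le by blast
next
  case False
  then obtain p where p: "continuous_on {0..1::real} p" "p 0 = b" "p 1 = a"
    using long_ray_path_le[of b a] by (metis linorder_linear)
  have "continuous_on {0..1} (\<lambda>t. p (1 - t))"
    by (rule continuous_on_compose2[OF p(1)]) (auto intro!: continuous_intros)
  then show ?thesis
    using p by (intro exI[of _ "\<lambda>t. p (1 - t)"]) simp
qed

lemma compact_long_ray_Icc: "compact {a..b :: long_ray}"
proof (cases "a \<le> b")
  case True
  then obtain p where "continuous_on {0..1::real} p" "p ` {0..1} = {a..b}"
    using long_ray_path_le by blast
  then show ?thesis
    by (metis compact_continuous_image compact_Icc)
qed simp

section \<open>Sequences and countable intersections at infinity\<close>

text \<open>The thresholds of the countably many conditions have a common upper bound.\<close>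

lemma eventually_at_top_countable:
  fixes P :: "'a \<Rightarrow> long_ray \<Rightarrow> bool"
  assumes "countable A" and "\<And>a. a \<in> A \<Longrightarrow> eventually (P a) at_top"
  shows "eventually (\<lambda>c. \<forall>a\<in>A. P a c) at_top"
proof -
  have "\<forall>a\<in>A. \<exists>k. \<forall>c\<ge>k. P a c"
    using assms(2) by (simp add: eventually_at_top_linorder)
  then obtain k where k: "\<forall>a\<in>A. \<forall>c\<ge>k a. P a c"
    by metis
  obtain b where "\<forall>x\<in>k ` A. x < b"
    using countable_imp_bounded_long_ray[of "k ` A"] assms(1) by auto
  then show ?thesis
    unfolding eventually_at_top_linorder using k by (intro exI[of _ b]) (force intro: less_imp_le less_le_trans)
qed

lemma long_ray_bdd_above_range [simp]: "bdd_above (range (X :: nat \<Rightarrow> long_ray))"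
proof -
  obtain b where "\<forall>x\<in>range X. x < b"
    using countable_imp_bounded_long_ray[of "range X"] by auto
  then show ?thesis
    by (intro bdd_aboveI[of _ b]) (auto intro: less_imp_le)
qed

text \<open>Iterating a function that sends \<open>c\<close> to a threshold for \<open>Q c\<close>
  gives an increasing sequence, which is bounded and so converges. Its limit lies beyond every
  threshold, hence \<open>Q (X k) c\<close> holds for all \<open>k\<close>.\<close>

lemma long_ray_interleave:
  fixes Q :: "long_ray \<Rightarrow> long_ray \<Rightarrow> bool"
  assumes "\<And>c. eventually (Q c) at_top"
  obtains X c where "X \<longlonglongrightarrow> c" "\<And>k::nat. z \<le> X k" "\<And>k. X k < c"
    "\<And>k c'. X (Suc k) \<le> c' \<Longrightarrow> Q (X k) c'"
proof -
  have "\<exists>s. \<forall>c. c < s c \<and> (\<forall>c'\<ge>s c. Q c c')"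
  proof (intro choice allI)
    fix c
    have "eventually (\<lambda>c'. c < c' \<and> Q c c') at_top"
      using eventually_gt_at_top assms by (rule eventually_conj)
    then show "\<exists>s. c < s \<and> (\<forall>c'\<ge>s. Q c c')"
      unfolding eventually_at_top_linorder by blast
  qed
  then obtain s where s: "\<And>c. c < s c" "\<And>c c'. s c \<le> c' \<Longrightarrow> Q c c'"
    by blast
  define X where "X k = (s ^^ k) z" for k
  have Suc: "X (Suc k) = s (X k)" for k
    by (simp add: X_def)
  have "strict_mono X"
    by (rule strict_monoI_Suc) (simp add: Suc s)
  then have inc: "incseq X"
    by (rule strict_mono_mono)
  have "X \<longlonglongrightarrow> (SUP i. X i)"
    by (rule LIMSEQ_incseq_SUP) (simp_all add: inc)
  moreover have "z \<le> X k" for k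
    using incseqD[OF inc, of 0 k] by (simp add: X_def)
  moreover have "X k < (SUP i. X i)" for k
    by (rule less_le_trans[of _ "X (Suc k)"], simp add: Suc s, rule cSUP_upper) simp_all
  ultimately show thesis
    by (rule that) (simp add: Suc s)
qed

text \<open>Every sequence is bounded, so a monotone subsequence converges to its supremum or
  infimum.\<close>

lemma long_ray_convergent_subseq:
  fixes X :: "nat \<Rightarrow> long_ray"
  obtains r l where "strict_mono r" "(X \<circ> r) \<longlonglongrightarrow> l"
proof -
  obtain r where r: "strict_mono r" "monoseq (X \<circ> r)"
    using seq_monosub[of X] by (auto simp: o_def)
  show thesis
  proof (cases "incseq (X \<circ> r)")
    case True
    then show thesis using LIMSEQ_incseq_SUP[of "X \<circ> r"] r that by simp
  next
    case False
    then have "decseq (X \<circ> r)"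
      using r(2) by (auto simp: monoseq_iff)
    then show thesis using LIMSEQ_decseq_INF[of "X \<circ> r"] r that by simp
  qed
qed

text \<open>Subsequences are extracted for one coordinate after the other.\<close>

lemma long_ray_convergent_subseq_finite:
  fixes X :: "nat \<Rightarrow> 'i \<Rightarrow> long_ray"
  assumes "finite M"
  shows "\<exists>r l. strict_mono (r :: nat \<Rightarrow> nat) \<and> (\<forall>i\<in>M. (\<lambda>k. X (r k) i) \<longlonglongrightarrow> l i)"
  using assms
proof induction
  case empty
  show ?case by (auto intro!: exI[of _ id] simp: strict_mono_def)
next
  case (insert j M)
  then obtain r l where r: "strict_mono r" "\<forall>i\<in>M. (\<lambda>k. X (r k) i) \<longlonglongrightarrow> l i"
    by auto
  obtain r' m where r': "strict_mono r'" "((\<lambda>k. X (r k) j) \<circ> r') \<longlonglongrightarrow> m"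
    by (rule long_ray_convergent_subseq)
  have "(\<lambda>k. X (r (r' k)) i) \<longlonglongrightarrow> (l(j := m)) i" if "i \<in> insert j M" for i
    using that r' LIMSEQ_subseq_LIMSEQ[OF _ r'(1), of "\<lambda>k. X (r k) i"] r(2) by (auto simp: o_def)
  then show ?case
    using strict_mono_o[OF r(1) r'(1), unfolded o_def] by blast
qed

section \<open>Families of maps of the long ray\<close>

text \<open>Otherwise, for some \<open>z < w\<close>, values at most \<open>z\<close> and values at
  least \<open>w\<close> both occur arbitrarily far out. Interleaving such points gives two
  sequences with a common limit \<open>c\<close>, and continuity forces \<open>h c \<le> z\<close>
  and \<open>w \<le> h c\<close>.\<close>

lemma long_ray_bounded_or_at_top:
  fixes h :: "long_ray \<Rightarrow> long_ray"
  assumes "continuous_on UNIV h"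
  shows "(\<exists>z. \<forall>x. h x \<le> z) \<or> filterlim h at_top at_top"
proof (rule ccontr)
  assume neg: "\<not> ?thesis"
  then obtain z where "\<not> eventually (\<lambda>x. z \<le> h x) at_top"
    by (auto simp: filterlim_at_top)
  then have low: "\<exists>x\<ge>c. h x \<le> z" for c
    unfolding eventually_at_top_linorder by (meson linorder_linear)
  obtain w where w: "z < w" using gt_ex by blast
  \<comment> \<open>If \<open>h\<close> stayed below \<open>w\<close> beyond \<open>c\<close>,
    compactness of \<open>{0..c}\<close> would make it bounded altogether.\<close>
  have high: "\<exists>x\<ge>c. w \<le> h x" for c
  proof (rule ccontr)
    assume below: "\<not> (\<exists>x\<ge>c. w \<le> h x)"
    have "compact (h ` {0..c})"
      using assms by (intro compact_continuous_image compact_long_ray_Icc) (auto intro: continuous_on_subset)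
    moreover have "h ` {0..c} \<noteq> {}"
      using zero_le_long_ray[of c] by simp
    ultimately obtain m where m: "\<forall>x\<in>{0..c}. h x \<le> m"
      using compact_attains_sup by (metis imageI)
    have "h x \<le> max m w" for x
    proof (cases "x \<le> c")
      case True
      then show ?thesis using m zero_le_long_ray[of x] by (simp add: max.coboundedI1)
    next
      case False
      then have "h x < w" using below by (meson le_less_linear less_imp_le)
      then show ?thesis by (simp add: max.coboundedI2)
    qed
    then show False using neg by blast
  qed
  have "eventually (\<lambda>c'. (\<exists>x\<in>{c..c'}. h x \<le> z) \<and> (\<exists>x\<in>{c..c'}. w \<le> h x)) at_top" for c
  proof -
    obtain x y where "c \<le> x" "h x \<le> z" "c \<le> y" "w \<le> h y"
      using low high by blast
    then have "\<forall>c'\<ge>max x y. (\<exists>x\<in>{c..c'}. h x \<le> z) \<and> (\<exists>x\<in>{c..c'}. w \<le> h x)"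
      by (intro allI impI conjI bexI[of _ x] bexI[of _ y]) simp_all
    then show ?thesis
      unfolding eventually_at_top_linorder by blast
  qed
  then obtain X c where Xc: "X \<longlonglongrightarrow> c"
    and "\<And>k::nat. 0 \<le> X k" "\<And>k. X k < c"
    and X: "\<And>k c'. X (Suc k) \<le> c' \<Longrightarrow> (\<exists>x\<in>{X k..c'}. h x \<le> z) \<and> (\<exists>x\<in>{X k..c'}. w \<le> h x)"
    by (rule long_ray_interleave[where z = 0 and
          Q = "\<lambda>c c'. (\<exists>x\<in>{c..c'}. h x \<le> z) \<and> (\<exists>x\<in>{c..c'}. w \<le> h x)"]) (rule that)
  have "\<forall>k. \<exists>x. x \<in> {X k..X (Suc k)} \<and> h x \<le> z" "\<forall>k. \<exists>x. x \<in> {X k..X (Suc k)} \<and> w \<le> h x"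
    using X[OF order_refl] by blast+
  then obtain u v where u: "\<And>k. u k \<in> {X k..X (Suc k)}" "\<And>k. h (u k) \<le> z"
    and v: "\<And>k. v k \<in> {X k..X (Suc k)}" "\<And>k. w \<le> h (v k)"
    unfolding choice_iff by blast
  have lim: "(\<lambda>k. h (t k)) \<longlonglongrightarrow> h c" if "\<And>k. t k \<in> {X k..X (Suc k)}" for t
  proof -
    have "t \<longlonglongrightarrow> c"
      by (rule tendsto_sandwich[OF _ _ Xc LIMSEQ_Suc[OF Xc]]) (use that in \<open>auto intro!: always_eventually\<close>)
    then show ?thesis
      using assms by (auto simp: continuous_on_eq_continuous_at intro: isCont_tendsto_compose)
  qed
  have "h c \<le> z" "w \<le> h c"
    using LIMSEQ_le_const2[OF lim[OF u(1)]] LIMSEQ_le_const[OF lim[OF v(1)]] u(2) v(2) by auto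
  then show False using w by simp
qed

text \<open>One point of \<open>A\<close> is chosen in each basic open set that meets
  \<open>A\<close>.\<close>

lemma second_countable_dense_subset:
  fixes A :: "'a :: second_countable_topology set"
  obtains D where "countable D" "D \<subseteq> A" "A \<subseteq> closure D"
proof -
  obtain B :: "'a set set" where B: "countable B" "topological_basis B"
    using ex_countable_basis by blast
  define e where "e U = (SOME x. x \<in> U \<inter> A)" for U
  have e: "e U \<in> U \<inter> A" if "U \<inter> A \<noteq> {}" for U
    unfolding e_def by (rule someI_ex) (use that in blast)
  define D where "D = e ` {U \<in> B. U \<inter> A \<noteq> {}}"
  have "countable D" using B by (auto simp: D_def)
  moreover have "D \<subseteq> A" using e by (auto simp: D_def)
  moreover have "A \<subseteq> closure D"
  proof
    fix x assume x: "x \<in> A"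
    show "x \<in> closure D"
    proof (rule closure_iff_nhds_not_empty[THEN iffD2], intro allI impI)
      fix S T assume "T \<subseteq> S" "open T" "x \<in> T"
      then obtain U where "U \<in> B" "x \<in> U" "U \<subseteq> T"
        using topological_basisE[OF B(2)] by metis
      then have "e U \<in> D \<inter> S"
        using x e[of U] \<open>T \<subseteq> S\<close> by (auto simp: D_def)
      then show "D \<inter> S \<noteq> {}" by blast
    qed
  qed
  ultimately show thesis by (rule that)
qed

lemma continuous_on_closure_imp_closed:
  assumes "continuous_on K f" "closed T" "D \<subseteq> K" "f ` D \<subseteq> T" "d \<in> K" "d \<in> closure D"
  shows "f d \<in> T"
proof -
  obtain C where C: "closed C" "K \<inter> f -` T = K \<inter> C"
    using continuous_closedin_preimage[OF assms(1,2)] by (auto simp: closedin_closed)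
  then have "closure D \<subseteq> C"
    using assms(3,4) by (intro closure_minimal) blast+
  then show ?thesis using C assms(5,6) by auto
qed

text \<open>\<open>K\<close> splits into the set \<open>B\<close> of parameters with bounded map and
  the set \<open>T\<close> of those tending to infinity. On a countable dense subset of either, the
  bounds or thresholds can be made uniform, and by continuity in the parameter they persist on the
  closure. So both sets are relatively closed, and connectedness leaves only one of them.\<close>

lemma long_ray_family:
  fixes F :: "long_ray \<Rightarrow> 'a :: second_countable_topology \<Rightarrow> long_ray"
  assumes K: "connected K" "e \<in> K"
    and F: "\<And>y. continuous_on K (F y)" "\<And>d. d \<in> K \<Longrightarrow> continuous_on UNIV (\<lambda>y. F y d)"
  shows long_ray_family_bounded:
      "(\<exists>z. \<forall>y. F y e \<le> z) \<Longrightarrow> \<exists>z. \<forall>d\<in>K. \<forall>y. F y d \<le> z" (is "?b \<Longrightarrow> ?B")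
    and long_ray_family_at_top:
      "\<not> (\<exists>z. \<forall>y. F y e \<le> z) \<Longrightarrow> eventually (\<lambda>y. \<forall>d\<in>K. z \<le> F y d) at_top" (is "_ \<Longrightarrow> ?T")
proof -
  define B where "B = {d \<in> K. \<exists>z. \<forall>y. F y d \<le> z}"
  define T where "T = {d \<in> K. filterlim (\<lambda>y. F y d) at_top at_top}"
  have BT: "K = B \<union> T"
    using long_ray_bounded_or_at_top[OF F(2)] by (auto simp: B_def T_def)
  have disj: "B \<inter> T = {}"
  proof -
    have False if "\<forall>y. F y d \<le> z" "filterlim (\<lambda>y. F y d) at_top at_top" for d z
    proof -
      obtain w where w: "z < w" using gt_ex by blast
      have "eventually (\<lambda>y. w \<le> F y d) at_top"
        using that(2) by (simp add: filterlim_at_top)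
      then obtain y where "w \<le> F y d"
        by (auto simp: eventually_at_top_linorder)
      then show False using that(1) w by (meson leD le_less_trans)
    qed
    then show ?thesis by (auto simp: B_def T_def)
  qed
  have clB: "\<exists>z. \<forall>d\<in>K \<inter> closure B. \<forall>y. F y d \<le> z"
  proof -
    obtain D where D: "countable D" "D \<subseteq> B" "B \<subseteq> closure D"
      by (rule second_countable_dense_subset)
    have "\<forall>d\<in>D. \<exists>z. \<forall>y. F y d \<le> z"
      using D(2) by (auto simp: B_def)
    then obtain b where b: "\<forall>d\<in>D. \<forall>y. F y d \<le> b d"
      unfolding bchoice_iff by blast
    obtain z where "\<forall>x\<in>b ` D. x < z"
      using countable_imp_bounded_long_ray[of "b ` D"] D(1) by auto
    then have *: "\<forall>d\<in>D. F y d \<le> z" for y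
      using b by (meson imageI less_imp_le order_trans)
    have "F y d \<le> z" if "d \<in> K" "d \<in> closure B" for y d
    proof -
      have "F y d \<in> {..z}"
        by (rule continuous_on_closure_imp_closed[OF F(1), where D = D])
          (use * D that closure_minimal[OF D(3)] in \<open>auto simp: B_def\<close>)
      then show ?thesis by simp
    qed
    then show ?thesis by blast
  qed
  have clT: "eventually (\<lambda>y. \<forall>d\<in>K \<inter> closure T. z \<le> F y d) at_top" for z
  proof -
    obtain D where D: "countable D" "D \<subseteq> T" "T \<subseteq> closure D"
      by (rule second_countable_dense_subset)
    have "eventually (\<lambda>y. \<forall>d\<in>D. z \<le> F y d) at_top"
      by (rule eventually_at_top_countable[OF D(1)])
        (use D(2) in \<open>auto simp: T_def filterlim_at_top\<close>)
    then show ?thesis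
    proof (rule eventually_mono, intro ballI)
      fix y d assume *: "\<forall>d\<in>D. z \<le> F y d" "d \<in> K \<inter> closure T"
      have "F y d \<in> {z..}"
        by (rule continuous_on_closure_imp_closed[OF F(1), where D = D])
          (use * D closure_minimal[OF D(3)] in \<open>auto simp: T_def\<close>)
      then show "z \<le> F y d" by simp
    qed
  qed
  have "K \<inter> closure B = B" "K \<inter> closure T = T"
  proof -
    have "d \<in> T" if "d \<in> K" "d \<in> closure T" for d
    proof -
      have "eventually (\<lambda>y. z \<le> F y d) at_top" for z
        using clT[of z] by (rule eventually_mono) (use that in auto)
      then show ?thesis using that(1) by (simp add: T_def filterlim_at_top)
    qed
    moreover have "d \<in> B" if "d \<in> K" "d \<in> closure B" for d
      using that clB by (auto simp: B_def)
    ultimately show "K \<inter> closure B = B" "K \<inter> closure T = T"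
      using closure_subset[of B] closure_subset[of T] BT by blast+
  qed
  then have cl: "K \<inter> closure B = B" "K \<inter> closure T = T" .
  have "closure B \<inter> closure T \<inter> K = {}" "K \<subseteq> closure B \<union> closure T"
    using cl BT disj by blast+
  then have split: "B = {} \<or> T = {}"
    using connected_closedD[OF K(1) _ _ closed_closure closed_closure] cl by (metis Int_commute)
  show ?B if ?b
  proof -
    have "e \<in> B" using that K(2) unfolding B_def by blast
    then have "K = B" using split BT by blast
    then show ?thesis using clB cl by auto
  qed
  show ?T if "\<not> ?b"
  proof -
    have "e \<notin> B" using that unfolding B_def by blast
    then have "K = T" using split BT K(2) by blast
    then show ?thesis using clT cl by auto
  qed
qed

section \<open>Behaviour along the diagonals\<close>

text \<open>For fixed \<open>q\<close>, varying \<open>y\<close> parametrises a diagonal; the values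
  of \<open>q\<close> on \<open>I\<close> are ignored. The restriction to \<open>{1..n}\<close>
  makes the result a point of the power.\<close>

definition diag_point :: "nat \<Rightarrow> nat set \<Rightarrow> long_ray \<Rightarrow> (nat \<Rightarrow> long_ray) \<Rightarrow> nat \<Rightarrow> long_ray" where
  "diag_point n I y q = (\<lambda>i\<in>{1..n}. if i \<in> I then y else q i)"

lemma topspace_long_ray_power: "x \<in> topspace (long_ray_power n) \<longleftrightarrow> x \<in> extensional {1..n}"
  by (simp add: long_ray_power_def PiE_def)

lemma diag_point_topspace [simp]: "diag_point n I y q \<in> topspace (long_ray_power n)"
  by (simp add: topspace_long_ray_power diag_point_def)

lemma diag_point_eqI:
  assumes "x \<in> topspace (long_ray_power n)" "\<And>i. i \<in> {1..n} \<Longrightarrow> i \<in> I \<Longrightarrow> x i = y"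
    "\<And>i. i \<in> {1..n} \<Longrightarrow> i \<notin> I \<Longrightarrow> x i = q i"
  shows "diag_point n I y q = x"
  using assms by (auto simp: topspace_long_ray_power diag_point_def extensional_def fun_eq_iff)

lemma continuous_map_diag_point:
  assumes "continuous_map X euclidean u" "\<And>i. i \<in> {1..n} \<Longrightarrow> continuous_map X euclidean (\<lambda>t. q t i)"
  shows "continuous_map X (long_ray_power n) (\<lambda>t. diag_point n I (u t) (q t))"
  unfolding long_ray_power_def continuous_map_componentwise
  using assms by (auto simp: diag_point_def)

text \<open>These are the two separate continuity conditions required by
  \<open>long_ray_family\<close>.\<close>

lemma continuous_on_diag_point:
  assumes f: "continuous_map (long_ray_power n) euclidean f"
  shows "continuous_on UNIV (\<lambda>y. f (diag_point n I y q))"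
    and "(\<And>i. i \<in> {1..n} \<Longrightarrow> continuous_on K (\<lambda>t. r t i)) \<Longrightarrow>
      continuous_on K (\<lambda>t. f (diag_point n I y (r t)))"
proof -
  have "continuous_map euclidean euclidean (\<lambda>y. f (diag_point n I y q))"
    by (rule continuous_map_compose[OF continuous_map_diag_point f, unfolded o_def]) auto
  then show "continuous_on UNIV (\<lambda>y. f (diag_point n I y q))" by simp
  assume "\<And>i. i \<in> {1..n} \<Longrightarrow> continuous_on K (\<lambda>t. r t i)"
  then have "continuous_map (top_of_set K) euclidean (\<lambda>t. f (diag_point n I y (r t)))"
    by (intro continuous_map_compose[OF continuous_map_diag_point f, unfolded o_def]) auto
  then show "continuous_on K (\<lambda>t. f (diag_point n I y (r t)))" by simp
qed

lemma cofinal_on_diag_iff: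
  assumes "I \<subseteq> {1..n}"
  shows "cofinal_on_diag n I f \<longleftrightarrow> \<not> (\<exists>z. \<forall>y. f (diag_point n I y (\<lambda>_. 0)) \<le> z)"
proof -
  have "diag n I (\<lambda>_. 0) = range (\<lambda>y. diag_point n I y (\<lambda>_. 0))"
  proof
    show "diag n I (\<lambda>_. 0) \<subseteq> range (\<lambda>y. diag_point n I y (\<lambda>_. 0))"
    proof
      fix x assume x: "x \<in> diag n I (\<lambda>_. 0)"
      \<comment> \<open>For empty \<open>I\<close> any \<open>y\<close> serves.\<close>
      have "\<exists>y. \<forall>i\<in>I. x i = y"
        using x unfolding diag_def by blast
      then obtain y where "\<forall>i\<in>I. x i = y" by blast
      then have "diag_point n I y (\<lambda>_. 0) = x"
        using x by (intro diag_point_eqI) (auto simp: diag_def)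
      then show "x \<in> range (\<lambda>y. diag_point n I y (\<lambda>_. 0))" by (metis rangeI)
    qed
    show "range (\<lambda>y. diag_point n I y (\<lambda>_. 0)) \<subseteq> diag n I (\<lambda>_. 0)"
      using assms by (auto simp: diag_def) (auto simp: diag_point_def subset_iff)
  qed
  then show ?thesis
    by (simp add: cofinal_on_diag_def bounded_map_on_def image_subset_iff zero_le_long_ray)
qed

text \<open>The cube \<open>{0..b}\<^sup>n\<close> is parametrised by \<open>K\<close>, which makes it a connected subset of
  a second countable type.\<close>

lemma diag_point_cube_family:
  assumes f: "continuous_map (long_ray_power n) euclidean f" and I: "I \<subseteq> {1..n}"
  shows cofinal_on_diag_uniform: "cofinal_on_diag n I f \<Longrightarrow>
      eventually (\<lambda>y. \<forall>q. (\<forall>i\<in>{1..n} - I. q i \<le> b) \<longrightarrow> z \<le> f (diag_point n I y q)) at_top"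
    and bounded_on_diag_uniform: "\<not> cofinal_on_diag n I f \<Longrightarrow>
      \<exists>z. \<forall>y q. (\<forall>i\<in>{1..n} - I. q i \<le> b) \<longrightarrow> f (diag_point n I y q) \<le> z"
proof -
  obtain p where p: "continuous_on {0..1::real} p" "p 0 = 0" "p ` {0..1} = {0..b}"
    using long_ray_path_le[OF zero_le_long_ray] by blast
  define K where "K = (PiE UNIV (\<lambda>_. {0..1}) :: (nat \<Rightarrow> real) set)"
  define F where "F y d = f (diag_point n I y (\<lambda>i. p (d i)))" for y d
  have K: "connected K"
    using connectedin_PiE[of "\<lambda>_. euclidean" UNIV "\<lambda>_. {0..1::real}"]
    by (simp add: K_def euclidean_product_topology)
  have K0: "(\<lambda>_. 0) \<in> K"
    by (auto simp: K_def)
  have cont: "continuous_on K (F y)" for y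
    unfolding F_def
    by (rule continuous_on_diag_point(2)[OF f], rule continuous_on_compose2[OF p(1)])
      (auto simp: K_def PiE_def Pi_def intro: continuous_on_subset[OF continuous_on_product_coordinates])
  have cont': "continuous_on UNIV (\<lambda>y. F y d)" for d
    unfolding F_def by (rule continuous_on_diag_point(1)[OF f])
  \<comment> \<open>Since \<open>p 0 = 0\<close>, the parameter 0 yields the diagonal through the
    origin. Cofinality thus concerns a single member of the family, and connectedness carries it to
    all others.\<close>
  have cof: "cofinal_on_diag n I f \<longleftrightarrow> \<not> (\<exists>z. \<forall>y. F y (\<lambda>_. 0) \<le> z)"
    using cofinal_on_diag_iff[OF I] by (simp add: F_def p)
  have surj: "\<exists>d\<in>K. \<forall>y. f (diag_point n I y q) = F y d" if "\<forall>i\<in>{1..n} - I. q i \<le> b" for q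
  proof -
    have "\<forall>i. \<exists>s\<in>{0..1}. i \<in> {1..n} - I \<longrightarrow> p s = q i"
    proof
      fix i show "\<exists>s\<in>{0..1}. i \<in> {1..n} - I \<longrightarrow> p s = q i"
      proof (cases "i \<in> {1..n} - I")
        case True
        then have "q i \<in> p ` {0..1}"
          using that zero_le_long_ray p(3) by auto
        then show ?thesis by force
      qed (use zero_le_one in force)
    qed
    then obtain d where d: "\<forall>i. d i \<in> {0..1} \<and> (i \<in> {1..n} - I \<longrightarrow> p (d i) = q i)"
      by metis
    then have "diag_point n I y q = diag_point n I y (\<lambda>i. p (d i))" for y
      by (auto simp: diag_point_def fun_eq_iff)
    then show ?thesis
      using d by (intro bexI[of _ d]) (auto simp: F_def K_def)
  qed
  show "eventually (\<lambda>y. \<forall>q. (\<forall>i\<in>{1..n} - I. q i \<le> b) \<longrightarrow> z \<le> f (diag_point n I y q)) at_top"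
    if "cofinal_on_diag n I f"
  proof -
    have "eventually (\<lambda>y. \<forall>d\<in>K. z \<le> F y d) at_top"
      using that cof by (intro long_ray_family_at_top[OF K K0 cont cont']) auto
    then show ?thesis
      by (rule eventually_mono) (metis surj)
  qed
  show "\<exists>z. \<forall>y q. (\<forall>i\<in>{1..n} - I. q i \<le> b) \<longrightarrow> f (diag_point n I y q) \<le> z"
    if "\<not> cofinal_on_diag n I f"
  proof -
    have "\<exists>z. \<forall>d\<in>K. \<forall>y. F y d \<le> z"
      using that cof by (intro long_ray_family_bounded[OF K K0 cont cont']) auto
    then show ?thesis
      using surj by metis
  qed
qed

text \<open>Restricted to the diagonal, a homotopy is a family over the connected interval of times,
  so boundedness at time 0 passes to time 1.\<close>

lemma homotopic_imp_cofinal_on_diag: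
  assumes "homotopic_with (\<lambda>_. True) (long_ray_power n) euclidean f g"
    and "cofinal_on_diag n I g" "I \<subseteq> {1..n}"
  shows "cofinal_on_diag n I f"
proof (rule ccontr)
  assume bdd: "\<not> cofinal_on_diag n I f"
  obtain h where h: "continuous_map (prod_topology (top_of_set {0..1::real}) (long_ray_power n)) euclidean h"
    and h01: "\<And>x. h (0, x) = f x" "\<And>x. h (1, x) = g x"
    using assms(1) by (auto simp: homotopic_with_def)
  define F where "F y t = h (t, diag_point n I y (\<lambda>_. 0))" for y and t :: real
  have "\<exists>z. \<forall>t\<in>{0..1}. \<forall>y. F y t \<le> z"
  proof (rule long_ray_family_bounded)
    fix y
    have "continuous_map (top_of_set {0..1}) euclidean (F y)"
      unfolding F_def
      by (rule continuous_map_compose[OF _ h, unfolded o_def])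
        (auto simp: continuous_map_pairwise o_def)
    then show "continuous_on {0..1} (F y)" by simp
  next
    fix t :: real assume t: "t \<in> {0..1}"
    have "continuous_map (long_ray_power n) euclidean (\<lambda>x. h (t, x))"
      by (rule continuous_map_compose[OF _ h, unfolded o_def])
        (use t in \<open>auto simp: continuous_map_pairwise o_def\<close>)
    then show "continuous_on UNIV (\<lambda>y. F y t)"
      unfolding F_def by (rule continuous_on_diag_point(1))
  next
    show "\<exists>z. \<forall>y. F y 0 \<le> z"
      using bdd cofinal_on_diag_iff[OF assms(3)] by (simp add: F_def h01)
  qed auto
  then have "\<exists>z. \<forall>y. F y 1 \<le> z" by force
  then show False
    using assms(2) cofinal_on_diag_iff[OF assms(3)] by (simp add: F_def h01)
qed

section \<open>Consequences of the cofinality class off the diagonals\<close>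

lemma tendsto_long_ray_power:
  assumes f: "continuous_map (long_ray_power n) euclidean f"
    and x: "\<And>k. x k \<in> topspace (long_ray_power n)" "l \<in> topspace (long_ray_power n)"
    and lim: "\<And>i. i \<in> {1..n} \<Longrightarrow> (\<lambda>k. x k i) \<longlonglongrightarrow> l i"
  shows "(\<lambda>k. f (x k)) \<longlonglongrightarrow> f l"
proof -
  have "limitin (long_ray_power n) x l sequentially"
    using x lim unfolding long_ray_power_def limitin_componentwise
    by (auto simp: limitin_canonical_iff PiE_def intro!: always_eventually)
  then have "limitin euclidean (f \<circ> x) (f l) sequentially"
    by (rule continuous_map_limit[OF f])
  then show ?thesis by (simp add: limitin_canonical_iff o_def)
qed

text \<open>Consider points with coordinates \<open>y\<close> on \<open>I\<close>,
  \<open>X k\<close> on the rest of \<open>J\<close> and 0 elsewhere, where \<open>X k\<close>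
  increases to \<open>y\<close>. Uniform cofinality along \<open>I\<close> makes \<open>f\<close> at
  least \<open>w\<close> at each of them, hence also at their limit on the diagonal of
  \<open>J\<close>.\<close>

lemma cofinal_on_diag_mono:
  assumes f: "continuous_map (long_ray_power n) euclidean f"
    and I: "cofinal_on_diag n I f" "I \<subseteq> J" "J \<subseteq> {1..n}"
  shows "cofinal_on_diag n J f"
proof (rule ccontr)
  assume "\<not> cofinal_on_diag n J f"
  then obtain z where z: "\<And>y. f (diag_point n J y (\<lambda>_. 0)) \<le> z"
    using cofinal_on_diag_iff[OF I(3)] by blast
  obtain w where w: "z < w" using gt_ex by blast
  have "eventually (\<lambda>c'. \<forall>q. (\<forall>i\<in>{1..n} - I. q i \<le> c) \<longrightarrow> w \<le> f (diag_point n I c' q)) at_top" for c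
    using I by (intro cofinal_on_diag_uniform[OF f]) auto
  then obtain X y where X: "X \<longlonglongrightarrow> y" "\<And>k::nat. 0 \<le> X k" "\<And>k. X k < y"
    and Q: "\<And>k c'. X (Suc k) \<le> c' \<Longrightarrow> \<forall>q. (\<forall>i\<in>{1..n} - I. q i \<le> X k) \<longrightarrow> w \<le> f (diag_point n I c' q)"
    by (rule long_ray_interleave[where z = 0 and
          Q = "\<lambda>c c'. \<forall>q. (\<forall>i\<in>{1..n} - I. q i \<le> c) \<longrightarrow> w \<le> f (diag_point n I c' q)"]) (rule that)
  define q where "q k i = (if i \<in> J then X k else 0)" for k i
  have "w \<le> f (diag_point n I y (q k))" for k
    using Q[of k y] X(2,3) by (auto simp: q_def less_imp_le)
  moreover have "(\<lambda>k. f (diag_point n I y (q k))) \<longlonglongrightarrow> f (diag_point n J y (\<lambda>_. 0))"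
  proof (rule tendsto_long_ray_power[OF f])
    show "(\<lambda>k. diag_point n I y (q k) i) \<longlonglongrightarrow> diag_point n J y (\<lambda>_. 0) i" if "i \<in> {1..n}" for i
      using that X(1) I(2) by (cases "i \<in> I"; cases "i \<in> J") (auto simp: diag_point_def q_def)
  qed simp_all
  ultimately have "w \<le> f (diag_point n J y (\<lambda>_. 0))"
    by (intro LIMSEQ_le_const) auto
  then show False using z[of y] w by simp
qed

text \<open>\<open>J\<close> is a maximal set of coordinates containing \<open>I\<close> that can be
  made arbitrarily large simultaneously within \<open>S\<close>. By maximality the other coordinates
  stay below some \<open>b\<close> once those in \<open>J\<close> are large. Interleaving squeezes
  the coordinates in \<open>J\<close> to a common limit \<open>y\<close>; a subsequence makes the
  others converge.\<close>

lemma long_ray_diagonal_limits: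
  fixes S :: "('i \<Rightarrow> long_ray) set"
  assumes M: "finite M" and I: "I \<subseteq> M" and S: "\<And>c. \<exists>u\<in>S. \<forall>i\<in>I. c \<le> u i"
  obtains J b where "I \<subseteq> J" "J \<subseteq> M"
    "\<And>z. \<exists>u l y. (\<forall>k::nat. u k \<in> S) \<and> (\<forall>i\<in>M. (\<lambda>k. u k i) \<longlonglongrightarrow> l i) \<and> z \<le> y \<and>
      (\<forall>i\<in>J. l i = y) \<and> (\<forall>i\<in>M - J. l i \<le> b)"
proof -
  define A where "A = {J. I \<subseteq> J \<and> J \<subseteq> M \<and> (\<forall>c. \<exists>u\<in>S. \<forall>i\<in>J. c \<le> u i)}"
  have "finite A"
    by (rule finite_subset[of _ "Pow M"]) (use M in \<open>auto simp: A_def\<close>)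
  moreover have "I \<in> A" using I S by (simp add: A_def)
  ultimately obtain J where J: "J \<in> A" and max: "\<And>J'. J' \<in> A \<Longrightarrow> J \<subseteq> J' \<Longrightarrow> J' = J"
    using finite_has_maximal2[of A I] by metis
  have JIM: "I \<subseteq> J" "J \<subseteq> M" and JS: "\<And>c. \<exists>u\<in>S. \<forall>i\<in>J. c \<le> u i"
    using J by (auto simp: A_def)
  have "eventually (\<lambda>b. \<forall>j\<in>M - J. \<forall>u\<in>S. (\<forall>i\<in>J. b \<le> u i) \<longrightarrow> u j \<le> b) at_top"
  proof (rule eventually_at_top_countable)
    show "countable (M - J)" using M by (simp add: countable_finite)
  next
    fix j assume j: "j \<in> M - J"
    then have "insert j J \<notin> A" using max[of "insert j J"] by auto
    then obtain c where c: "\<And>u. u \<in> S \<Longrightarrow> \<exists>i\<in>insert j J. u i < c"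
      using j JIM unfolding A_def by (simp add: not_le Bex_def Ball_def) blast
    \<comment> \<open>If \<open>u j\<close> exceeded \<open>b\<close>, all coordinates in
      \<open>insert j J\<close> would be at least \<open>c\<close>, contrary to the choice of
      \<open>c\<close>.\<close>
    have "u j \<le> b" if "c \<le> b" "u \<in> S" "\<forall>i\<in>J. b \<le> u i" for b u
    proof (rule ccontr)
      assume "\<not> u j \<le> b"
      then have "\<forall>i\<in>insert j J. c \<le> u i" using that by (auto intro: order_trans)
      then show False using c[OF that(2)] by (auto simp: not_le[symmetric])
    qed
    then show "eventually (\<lambda>b. \<forall>u\<in>S. (\<forall>i\<in>J. b \<le> u i) \<longrightarrow> u j \<le> b) at_top"
      unfolding eventually_at_top_linorder by blast
  qed
  then obtain b where b: "\<And>j u. j \<in> M - J \<Longrightarrow> u \<in> S \<Longrightarrow> \<forall>i\<in>J. b \<le> u i \<Longrightarrow> u j \<le> b"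
    unfolding eventually_at_top_linorder by blast
  have "\<exists>u l y. (\<forall>k::nat. u k \<in> S) \<and> (\<forall>i\<in>M. (\<lambda>k. u k i) \<longlonglongrightarrow> l i) \<and> z \<le> y \<and>
      (\<forall>i\<in>J. l i = y) \<and> (\<forall>i\<in>M - J. l i \<le> b)" for z
  proof -
    have "eventually (\<lambda>c'. \<exists>u\<in>S. (\<forall>i\<in>J. c \<le> u i \<and> u i \<le> c') \<and> (\<forall>i\<in>M - J. u i \<le> b)) at_top" for c
    proof -
      obtain u where u: "u \<in> S" "\<forall>i\<in>J. max b c \<le> u i" using JS by blast
      have "countable J" using JIM(2) M by (meson countable_finite finite_subset)
      then have "eventually (\<lambda>c'. \<forall>i\<in>J. u i \<le> c') at_top"
        by (rule eventually_at_top_countable) (rule eventually_ge_at_top)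
      then show ?thesis
        by (rule eventually_mono) (use u b in \<open>intro bexI[of _ u]; simp\<close>)
    qed
    then obtain X y where X: "X \<longlonglongrightarrow> y" "\<And>k::nat. z \<le> X k" "\<And>k. X k < y"
      and "\<And>k c'. X (Suc k) \<le> c' \<Longrightarrow>
        \<exists>u\<in>S. (\<forall>i\<in>J. X k \<le> u i \<and> u i \<le> c') \<and> (\<forall>i\<in>M - J. u i \<le> b)"
      by (rule long_ray_interleave[where z = z and Q = "\<lambda>c c'.
            \<exists>u\<in>S. (\<forall>i\<in>J. c \<le> u i \<and> u i \<le> c') \<and> (\<forall>i\<in>M - J. u i \<le> b)"]) (rule that)
    then have "\<forall>k. \<exists>u. u \<in> S \<and> (\<forall>i\<in>J. X k \<le> u i \<and> u i \<le> X (Suc k)) \<and> (\<forall>i\<in>M - J. u i \<le> b)"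
      by blast
    then obtain u where u: "\<And>k. u k \<in> S" "\<And>k i. i \<in> J \<Longrightarrow> X k \<le> u k i \<and> u k i \<le> X (Suc k)"
      "\<And>k i. i \<in> M - J \<Longrightarrow> u k i \<le> b"
      unfolding choice_iff by blast
    obtain r l where r: "strict_mono (r :: nat \<Rightarrow> nat)" "\<forall>i\<in>M. (\<lambda>k. u (r k) i) \<longlonglongrightarrow> l i"
      using long_ray_convergent_subseq_finite[OF M] by blast
    have "l i = y" if i: "i \<in> J" for i
    proof -
      have "(\<lambda>k. u k i) \<longlonglongrightarrow> y"
        by (rule tendsto_sandwich[OF _ _ X(1) LIMSEQ_Suc[OF X(1)]])
          (use u(2)[OF i] in \<open>auto intro!: always_eventually\<close>)
      from LIMSEQ_subseq_LIMSEQ[OF this r(1)] show ?thesis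
        using r(2) i JIM(2) LIMSEQ_unique unfolding o_def by blast
    qed
    moreover have "l i \<le> b" if "i \<in> M - J" for i
      using r(2) that u(3) by (intro LIMSEQ_le_const2[of "\<lambda>k. u (r k) i"]) auto
    moreover have "z \<le> y"
      using X(2,3)[of 0] by simp
    ultimately show ?thesis
      using u(1) r(2) by (intro exI[of _ "\<lambda>k. u (r k)"] exI[of _ l] exI[of _ y]) auto
  qed
  with JIM show thesis by (rule that)
qed

text \<open>Points violating the claim would have a diagonal limit for some \<open>J\<close>
  containing \<open>I\<close>, with value at most \<open>z\<close>. But \<open>J\<close> is in the
  class by monotonicity, so far out on its diagonals the value is at least
  \<open>w > z\<close>.\<close>

lemma cofinal_on_diag_at_top:
  assumes f: "continuous_map (long_ray_power n) euclidean f"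
    and I: "cofinal_on_diag n I f" "I \<subseteq> {1..n}"
  shows "eventually (\<lambda>c. \<forall>x\<in>topspace (long_ray_power n). (\<forall>i\<in>I. c \<le> x i) \<longrightarrow> z \<le> f x) at_top"
proof (rule ccontr)
  assume neg: "\<not> ?thesis"
  define S where "S = {x \<in> topspace (long_ray_power n). f x \<le> z}"
  have "\<exists>x\<in>S. \<forall>i\<in>I. c \<le> x i" for c
  proof -
    obtain c' x where "c \<le> c'" "x \<in> topspace (long_ray_power n)" "\<forall>i\<in>I. c' \<le> x i" "\<not> z \<le> f x"
      using neg unfolding eventually_at_top_linorder by blast
    then show ?thesis unfolding S_def by (intro bexI[of _ x]) auto
  qed
  then obtain J b where J: "I \<subseteq> J" "J \<subseteq> {1..n}"
    and L: "\<And>z. \<exists>u l y. (\<forall>k::nat. u k \<in> S) \<and> (\<forall>i\<in>{1..n}. (\<lambda>k. u k i) \<longlonglongrightarrow> l i) \<and> z \<le> y \<and>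
      (\<forall>i\<in>J. l i = y) \<and> (\<forall>i\<in>{1..n} - J. l i \<le> b)"
    by (rule long_ray_diagonal_limits[OF finite_atLeastAtMost I(2)]) (rule that)
  obtain w where w: "z < w" using gt_ex by blast
  obtain c where c: "\<And>y q. c \<le> y \<Longrightarrow> \<forall>i\<in>{1..n} - J. q i \<le> b \<Longrightarrow> w \<le> f (diag_point n J y q)"
    using cofinal_on_diag_uniform[OF f J(2) cofinal_on_diag_mono[OF f I(1) J], of b w]
    unfolding eventually_at_top_linorder by blast
  \<comment> \<open>The bound \<open>b\<close> was fixed before \<open>c\<close>, so a limit with
    \<open>y\<close> beyond \<open>c\<close> is available.\<close>
  obtain u l y where u: "\<And>k::nat. u k \<in> S" and ul: "\<forall>i\<in>{1..n}. (\<lambda>k. u k i) \<longlonglongrightarrow> l i"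
    and y: "c \<le> y" "\<forall>i\<in>J. l i = y" "\<forall>i\<in>{1..n} - J. l i \<le> b"
    using L by blast
  have "(\<lambda>k. f (u k)) \<longlonglongrightarrow> f (diag_point n J y l)"
    using u ul y by (intro tendsto_long_ray_power[OF f]) (auto simp: S_def diag_point_def topspace_long_ray_power)
  then have "f (diag_point n J y l) \<le> z"
    by (rule LIMSEQ_le_const2) (use u in \<open>auto simp: S_def\<close>)
  then show False using c[OF y(1,3)] w by simp
qed

text \<open>If \<open>f\<close> were unbounded there, diagonal limits taken jointly in the
  coordinates and the value of \<open>f\<close> would give points where \<open>f\<close> equals the
  arbitrarily large common coordinate \<open>y\<close> on \<open>J'\<close>. The constraint off
  \<open>I\<close> forces \<open>J' \<subseteq> I\<close>, so \<open>J'\<close> is outside the class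
  and \<open>f\<close> is bounded at these points.\<close>

lemma not_cofinal_on_diag_bounded:
  assumes f: "continuous_map (long_ray_power n) euclidean f"
    and I: "\<not> cofinal_on_diag n I f" "I \<subseteq> {1..n}"
  shows "\<exists>z. \<forall>x\<in>topspace (long_ray_power n). (\<forall>i\<in>{1..n} - I. x i \<le> b) \<longrightarrow> f x \<le> z"
proof (rule ccontr)
  assume neg: "\<not> ?thesis"
  define T where "T = {x \<in> topspace (long_ray_power n). \<forall>i\<in>{1..n} - I. x i \<le> b}"
  \<comment> \<open>The index 0, free since coordinates start at 1, stores the value of
    \<open>f\<close>, so that the value counts as one more coordinate tending to infinity.\<close>
  define S where "S = (\<lambda>x. x(0 := f x)) ` T"
  have S: "\<exists>u\<in>S. \<forall>i\<in>{0}. c \<le> u i" for c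
  proof -
    obtain x where "x \<in> T" "\<not> f x \<le> c"
      using neg unfolding T_def by blast
    then show ?thesis unfolding S_def by (intro bexI[of _ "x(0 := f x)"]) auto
  qed
  have "{0} \<subseteq> {0..n}" by simp
  then obtain J b' where J: "{0} \<subseteq> J" "J \<subseteq> {0..n}"
    and L: "\<And>z. \<exists>u l y. (\<forall>k::nat. u k \<in> S) \<and> (\<forall>i\<in>{0..n}. (\<lambda>k. u k i) \<longlonglongrightarrow> l i) \<and> z \<le> y \<and>
      (\<forall>i\<in>J. l i = y) \<and> (\<forall>i\<in>{0..n} - J. l i \<le> b')"
    by (rule long_ray_diagonal_limits[OF finite_atLeastAtMost _ S]) (rule that)
  define J' where "J' = J - {0}"
  have J': "J' \<subseteq> {1..n}" using J(2) by (force simp: J'_def)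
  have limits: "\<exists>q y. z \<le> y \<and> f (diag_point n J' y q) = y \<and>
      (\<forall>i\<in>{1..n} - J'. q i \<le> b') \<and> (\<forall>i\<in>J' - I. y \<le> b)" for z
  proof -
    obtain u l y where u: "\<And>k::nat. u k \<in> S" and ul: "\<forall>i\<in>{0..n}. (\<lambda>k. u k i) \<longlonglongrightarrow> l i"
      and y: "z \<le> y" "\<forall>i\<in>J. l i = y" "\<forall>i\<in>{0..n} - J. l i \<le> b'"
      using L by blast
    have "\<forall>k. \<exists>x. x \<in> T \<and> u k = x(0 := f x)"
      using u by (auto simp: S_def)
    then obtain x where x: "\<And>k. x k \<in> T" "\<And>k. u k = (x k)(0 := f (x k))"
      unfolding choice_iff by blast
    have xl: "(\<lambda>k. x k i) \<longlonglongrightarrow> l i" if "i \<in> {1..n}" for i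
    proof -
      have "(\<lambda>k. u k i) \<longlonglongrightarrow> l i" using ul that by auto
      then show ?thesis using that by (simp add: x(2))
    qed
    have "(\<lambda>k. f (x k)) \<longlonglongrightarrow> f (diag_point n J' y l)"
      using x(1) xl y(2) by (intro tendsto_long_ray_power[OF f]) (auto simp: T_def diag_point_def J'_def topspace_long_ray_power)
    moreover have "(\<lambda>k. f (x k)) \<longlonglongrightarrow> y"
      using ul[rule_format, of 0] y(2) J(1) by (simp add: x(2))
    ultimately have "f (diag_point n J' y l) = y"
      by (rule LIMSEQ_unique)
    moreover have "y \<le> b" if "i \<in> J' - I" for i
    proof -
      have "l i \<le> b"
        by (rule LIMSEQ_le_const2[OF xl]) (use that J' x(1) in \<open>auto simp: T_def\<close>)
      then show ?thesis using that y(2) by (simp add: J'_def)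
    qed
    moreover have "\<forall>i\<in>{1..n} - J'. l i \<le> b'"
      using y(3) by (auto simp: J'_def)
    ultimately show ?thesis using y(1) by blast
  qed
  \<comment> \<open>An index in \<open>J' - I\<close> would give \<open>y \<le> b\<close>, which
    fails once \<open>y\<close> is requested beyond \<open>b\<close>.\<close>
  have "J' \<subseteq> I"
  proof -
    obtain z where "b < z" using gt_ex by blast
    then show ?thesis using limits[of z] by (meson DiffI leD le_less_trans less_le_trans subsetI)
  qed
  then have "\<not> cofinal_on_diag n J' f"
    using cofinal_on_diag_mono[OF f _ _ I(2)] I(1) by blast
  then obtain w where w: "\<And>y q. \<forall>i\<in>{1..n} - J'. q i \<le> b' \<Longrightarrow> f (diag_point n J' y q) \<le> w"
    using bounded_on_diag_uniform[OF f J'] by blast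
  obtain z where "w < z" using gt_ex by blast
  then show False using limits[of z] w by (metis leD less_le_trans)
qed

section \<open>Separating levels and the homotopy\<close>

text \<open>There are only finitely many \<open>I\<close>, so one threshold serves both the lower
  bounds for the class and the upper bounds for its complement.\<close>

lemma eventually_cofinality_bounds:
  assumes f: "continuous_map (long_ray_power n) euclidean f"
  shows "eventually (\<lambda>c'. \<forall>I\<in>Pow {1..n}. \<forall>x\<in>topspace (long_ray_power n).
    if cofinal_on_diag n I f then (\<forall>i\<in>I. c' \<le> x i) \<longrightarrow> c \<le> f x
    else (\<forall>i\<in>{1..n} - I. x i \<le> c) \<longrightarrow> f x \<le> c') at_top" (is "eventually (\<lambda>c'. \<forall>I\<in>_. ?P I c') _")
proof (rule eventually_at_top_countable)
  show "countable (Pow {1..n})"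
    by (intro countable_finite) simp
  fix I assume "I \<in> Pow {1..n}"
  then have I: "I \<subseteq> {1..n}" by simp
  show "eventually (?P I) at_top"
  proof (cases "cofinal_on_diag n I f")
    case True
    then show ?thesis
      using cofinal_on_diag_at_top[OF f True I] by simp
  next
    case False
    then obtain z where z: "\<forall>x\<in>topspace (long_ray_power n). (\<forall>i\<in>{1..n} - I. x i \<le> c) \<longrightarrow> f x \<le> z"
      using not_cofinal_on_diag_bounded[OF f False I] by blast
    have "?P I c'" if "z \<le> c'" for c'
      using False z that order_trans[OF _ that] by simp
    then show ?thesis
      by (rule eventually_mono[OF eventually_ge_at_top])
  qed
qed

text \<open>A limit \<open>c\<close> of interleaved levels is closed under the bounds of both maps.
  Whether \<open>{i\<in>{1..n}. c \<le> x i}\<close> is in the class then decides on which side of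
  \<open>c\<close> a value at \<open>x\<close> lies, and the two classes agree.\<close>

lemma unbounded_separating_levels:
  assumes f: "continuous_map (long_ray_power n) euclidean f"
    and g: "continuous_map (long_ray_power n) euclidean g"
    and eq: "cofinality_class n f = cofinality_class n g"
  shows "\<exists>c\<ge>z. \<forall>x\<in>topspace (long_ray_power n). c \<le> f x \<and> c \<le> g x \<or> f x \<le> c \<and> g x \<le> c"
proof -
  define Q where "Q h c c' \<longleftrightarrow> (\<forall>I\<in>Pow {1..n}. \<forall>x\<in>topspace (long_ray_power n).
    if cofinal_on_diag n I h then (\<forall>i\<in>I. c' \<le> x i) \<longrightarrow> c \<le> h x
    else (\<forall>i\<in>{1..n} - I. x i \<le> c) \<longrightarrow> h x \<le> c')" for h c c'
  have "eventually (\<lambda>c'. Q f c c' \<and> Q g c c') at_top" for c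
    unfolding Q_def by (intro eventually_conj eventually_cofinality_bounds f g)
  then obtain X c where X: "X \<longlonglongrightarrow> c" "\<And>k::nat. z \<le> X k" "\<And>k. X k < c"
    and Q: "\<And>k c'. X (Suc k) \<le> c' \<Longrightarrow> Q f (X k) c' \<and> Q g (X k) c'"
    by (rule long_ray_interleave[where z = z and Q = "\<lambda>c c'. Q f c c' \<and> Q g c c'"]) (rule that)
  have level: "if cofinal_on_diag n {i\<in>{1..n}. c \<le> x i} h then c \<le> h x else h x \<le> c"
    if h: "\<And>k. Q h (X k) c" and x: "x \<in> topspace (long_ray_power n)" for h x
  proof -
    let ?I = "{i\<in>{1..n}. c \<le> x i}"
    have Qx: "if cofinal_on_diag n ?I h then (\<forall>i\<in>?I. c \<le> x i) \<longrightarrow> X k \<le> h x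
      else (\<forall>i\<in>{1..n} - ?I. x i \<le> X k) \<longrightarrow> h x \<le> c" for k
      using h[of k] x unfolding Q_def by blast
    show ?thesis
    proof (cases "cofinal_on_diag n ?I h")
      case True
      then have "X k \<le> h x" for k using Qx[of k] by simp
      then show ?thesis using True LIMSEQ_le_const2[OF X(1)] by auto
    next
      case False
      \<comment> \<open>The remaining coordinates are finitely many and strictly below the limit
        \<open>c\<close>, so a single \<open>X k\<close> dominates them.\<close>
      have "eventually (\<lambda>k. \<forall>i\<in>{1..n} - ?I. x i \<le> X k) sequentially"
      proof (rule eventually_ball_finite)
        show "\<forall>i\<in>{1..n} - ?I. eventually (\<lambda>k. x i \<le> X k) sequentially"
        proof
          fix i assume "i \<in> {1..n} - ?I"
          then have "x i < c" by auto
          then show "eventually (\<lambda>k. x i \<le> X k) sequentially"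
            by (intro eventually_mono[OF order_tendstoD(1)[OF X(1)]]) auto
        qed
      qed simp
      then obtain k where "\<forall>i\<in>{1..n} - ?I. x i \<le> X k"
        by (auto simp: eventually_sequentially)
      then show ?thesis using Qx[of k] False by simp
    qed
  qed
  have same: "cofinal_on_diag n I f \<longleftrightarrow> cofinal_on_diag n I g" if "I \<subseteq> {1..n}" for I
    using eq that by (auto simp: cofinality_class_def set_eq_iff)
  have "c \<le> f x \<and> c \<le> g x \<or> f x \<le> c \<and> g x \<le> c" if x: "x \<in> topspace (long_ray_power n)" for x
  proof -
    have "Q f (X k) c" "Q g (X k) c" for k
      using Q[of k c] X(3)[of "Suc k"] by auto
    moreover have "cofinal_on_diag n {i\<in>{1..n}. c \<le> x i} f \<longleftrightarrow> cofinal_on_diag n {i\<in>{1..n}. c \<le> x i} g"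
      by (rule same) auto
    ultimately show ?thesis
      using level[of f x] level[of g x] x by (auto split: if_splits)
  qed
  moreover have "z \<le> c" using X(2,3)[of 0] by simp
  ultimately show ?thesis by blast
qed

text \<open>Between consecutive separating levels the homotopy follows a path \<open>G\<close> from the lower to
  the upper level, clipped to the interval between \<open>f x\<close> and \<open>g x\<close>. Near a given value \<open>r\<close> the
  path depends on \<open>r\<close> only, not on \<open>x\<close>, whence continuity.\<close>

lemma homotopic_with_max:
  fixes f g :: "'a \<Rightarrow> long_ray"
  assumes f: "continuous_map T euclidean f" and g: "continuous_map T euclidean g"
    and levels: "\<And>z. \<exists>c\<ge>z. \<forall>x\<in>topspace T. c \<le> f x \<and> c \<le> g x \<or> f x \<le> c \<and> g x \<le> c"
  shows "homotopic_with (\<lambda>_. True) T euclidean f (\<lambda>x. max (f x) (g x))"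
proof -
  define C where "C = {c. \<forall>x\<in>topspace T. c \<le> f x \<and> c \<le> g x \<or> f x \<le> c \<and> g x \<le> c}"
  obtain G :: "long_ray \<Rightarrow> long_ray \<Rightarrow> real \<Rightarrow> long_ray"
    where G: "\<And>a b. continuous_on {0..1} (G a b)" "\<And>a b. G a b 0 = a" "\<And>a b. G a b 1 = b"
    using long_ray_path by metis
  \<comment> \<open>Where \<open>g x \<le> f x\<close>, this is \<open>f x\<close> for every
    \<open>t\<close>; elsewhere it is the path clipped to \<open>{f x..g x}\<close>.\<close>
  define k where "k a b = (\<lambda>(t, x). max (f x) (min (g x) (G a b t)))" for a b
  define h where "h = (\<lambda>(t, x). k (Sup {c \<in> C. c \<le> f x}) (Inf {c \<in> C. g x \<le> c}) (t, x))"
  let ?X = "prod_topology (top_of_set {0..1::real}) T"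
  have k: "continuous_map ?X euclidean (k a b)" for a b
  proof -
    have "continuous_map ?X euclidean (\<lambda>z. f (snd z))" "continuous_map ?X euclidean (\<lambda>z. g (snd z))"
      using continuous_map_compose[OF continuous_map_snd f] continuous_map_compose[OF continuous_map_snd g]
      by (auto simp: o_def)
    moreover have "continuous_map ?X euclidean (\<lambda>z. G a b (fst z))"
      using continuous_map_compose[OF continuous_map_fst, of "top_of_set {0..1}" euclidean "G a b" T] G(1)
      by (auto simp: o_def)
    ultimately show ?thesis
      unfolding k_def case_prod_unfold continuous_map_atin limitin_canonical_iff
      by (intro ballI tendsto_max tendsto_min) blast+
  qed
  have less: "openin ?X {z \<in> topspace ?X. k a b z < r}" and greater: "openin ?X {z \<in> topspace ?X. r < k a b z}"
    for a b r
    using openin_continuous_map_preimage[OF k, of "{..<r}"] openin_continuous_map_preimage[OF k, of "{r<..}"]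
    by simp_all
  \<comment> \<open>Only \<open>f x \<le> r < g x\<close> needs an argument: no level lies strictly
    between \<open>f x\<close> and \<open>g x\<close>, so the neighbouring levels of
    \<open>r\<close> are those used by \<open>h\<close> at \<open>x\<close>. Hence the preimage of
    \<open>{r<..}\<close> under \<open>h\<close> is that under one fixed continuous
    \<open>k a b\<close>.\<close>
  have h_greater: "r < h z \<longleftrightarrow> r < k (Sup {c \<in> C. c \<le> r}) (Inf {c \<in> C. r < c}) z"
    if zX: "z \<in> topspace ?X" for z r
  proof -
    obtain t x where z: "z = (t, x)" "x \<in> topspace T"
      using zX by (cases z) auto
    show ?thesis
    proof (cases "f x \<le> r \<and> r < g x")
      case True
      then have "{c \<in> C. c \<le> r} = {c \<in> C. c \<le> f x}" "{c \<in> C. r < c} = {c \<in> C. g x \<le> c}"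
        using z(2) by (force simp: C_def)+
      then show ?thesis by (simp add: h_def z)
    qed (auto simp: h_def k_def z less_max_iff_disj)
  qed
  \<comment> \<open>Here the critical case is \<open>f x < r \<le> g x\<close>, so strict and weak
    comparison with \<open>r\<close> change places.\<close>
  have h_less: "h z < r \<longleftrightarrow> k (Sup {c \<in> C. c < r}) (Inf {c \<in> C. r \<le> c}) z < r"
    if zX: "z \<in> topspace ?X" for z r
  proof -
    obtain t x where z: "z = (t, x)" "x \<in> topspace T"
      using zX by (cases z) auto
    show ?thesis
    proof (cases "f x < r \<and> r \<le> g x")
      case True
      then have "{c \<in> C. c < r} = {c \<in> C. c \<le> f x}" "{c \<in> C. r \<le> c} = {c \<in> C. g x \<le> c}"
        using z(2) by (force simp: C_def)+
      then show ?thesis by (simp add: h_def z)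
    qed (auto simp: h_def k_def z min_less_iff_disj)
  qed
  have "continuous_map ?X euclidean h"
    unfolding continuous_map_upper_lower_semicontinuous_lt
    using less greater by (simp add: h_greater h_less cong: conj_cong)
  moreover have "h (0, x) = f x" for x
  proof -
    \<comment> \<open>The level 0 makes the set of levels below \<open>f x\<close> nonempty, so the
      path starts at or below \<open>f x\<close> and is clipped to it.\<close>
    have "0 \<in> C" by (simp add: C_def zero_le_long_ray)
    then have "Sup {c \<in> C. c \<le> f x} \<le> f x"
      by (intro cSup_least) (auto simp: zero_le_long_ray)
    then show ?thesis by (simp add: h_def k_def G max_absorb1 min.coboundedI2)
  qed
  moreover have "h (1, x) = max (f x) (g x)" for x
  proof -
    \<comment> \<open>Unboundedness of the levels enters here: the path ends at or above
      \<open>g x\<close>.\<close>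
    have "{c \<in> C. g x \<le> c} \<noteq> {}"
      using levels[of "g x"] by (auto simp: C_def)
    then have "g x \<le> Inf {c \<in> C. g x \<le> c}"
      by (rule cInf_greatest) auto
    then show ?thesis by (simp add: h_def k_def G min_absorb1)
  qed
  ultimately show ?thesis
    unfolding homotopic_with_def by blast
qed

text \<open>Both maps are homotopic to their maximum.\<close>

lemma same_cofinality_class_imp_homotopic:
  assumes "continuous_map (long_ray_power n) euclidean f" "continuous_map (long_ray_power n) euclidean g"
    and "cofinality_class n f = cofinality_class n g"
  shows "homotopic_with (\<lambda>_. True) (long_ray_power n) euclidean f g"
proof -
  have "homotopic_with (\<lambda>_. True) (long_ray_power n) euclidean f (\<lambda>x. max (f x) (g x))"
    by (rule homotopic_with_max[OF assms(1,2)], rule unbounded_separating_levels[OF assms])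
  moreover have "homotopic_with (\<lambda>_. True) (long_ray_power n) euclidean g (\<lambda>x. max (g x) (f x))"
    by (rule homotopic_with_max[OF assms(2,1)], rule unbounded_separating_levels[OF assms(2,1) assms(3)[symmetric]])
  ultimately show ?thesis
    unfolding max.commute[of "g _"] by (meson homotopic_with_sym homotopic_with_trans)
qed

theorem theorem1:
  fixes n :: nat and f g :: "(nat \<Rightarrow> long_ray) \<Rightarrow> long_ray"
  assumes "n \<ge> 1"
    and "continuous_map (long_ray_power n) euclidean f"
    and "continuous_map (long_ray_power n) euclidean g"
  shows "homotopic_with (\<lambda>_. True) (long_ray_power n) euclidean f g \<longleftrightarrow>
         cofinality_class n f = cofinality_class n g"
proof
  assume fg: "homotopic_with (\<lambda>_. True) (long_ray_power n) euclidean f g"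
  \<comment> \<open>The homotopy yields one inclusion of the classes, its reverse the other.\<close>
  then have "homotopic_with (\<lambda>_. True) (long_ray_power n) euclidean g f"
    by (rule homotopic_with_symD)
  with fg show "cofinality_class n f = cofinality_class n g"
    using homotopic_imp_cofinal_on_diag unfolding cofinality_class_def by blast
next
  assume "cofinality_class n f = cofinality_class n g"
  then show "homotopic_with (\<lambda>_. True) (long_ray_power n) euclidean f g"
    using assms(2,3) by (intro same_cofinality_class_imp_homotopic)
qed

end
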